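(* Let $k\ge1$ and $d>0$. The span of the functionals $\varphi_e$ indexed by the zero rows $e$ of $\overline M(k,d)$ is a $z(k,d)$-dimensional subspace of the dual-spike module $J_k(d)$, where $z(k,d)$ is the number of zero rows of $\overline M(k,d)$.
   Context: $\mathbb N$ includes $0$. $\mathcal P_k=\mathbb F_2[x_1,\dots,x_k]$ with $\deg x_i=1$; $\mathcal P_k^n$ is the degree-$n$ part (zero for $n<0$). For $e\in\mathbb N^k$, $x^e=\prod x_i^{e_i}$, $|e|=\sum e_i$; $\varepsilon_i$ is the $i$th standard vector. Steenrod squares act linearly by $\mathrm{Sq}^r(x^a)=\sum_{b\in\mathbb N^k,|b|=r}\prod_i\binom{a_i}{b_i}x^{a+b}$ (mod 2). For $e\neq0$ put $i(e)=\min\{i:e_i>0\}$. The linear map $h$ is given by $h(x^e)=x^{e-\varepsilon_{i(e)}}$ if $e_{i(e)}$ is even, $h(x^e)=0$ if $e_{i(e)}$ is odd, and $h(1)=0$. For $d>0$, $p_d=h\,\mathrm{Sq}^1:\mathcal P_k^d\to\mathcal P_k^d$, and $\mathcal T_d(k)$ is the set of degree-$d$ monomials $x^e$ with $e_{i(e)}$ odd; the image of $p_d$ is the span of $\mathcal T_d(k)$. $\overline M(k,d)$ is the matrix with row basis $\mathcal T_d(k)$ and labelled columns $p_d\mathrm{Sq}^{2^t}(g)$ for $t\ge1$, $2^t\le d$, $g$ a monomial of degree $d-2^t$. Let $\{(x^e)^*\}_{|e|=d}$ be the basis of $(\mathcal P_k^d)^*$ dual to the monomials. For $x^e\in\mathcal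 T_d(k)$ and $i=i(e)$ put $$\varphi_e=(x^e)^*+\sum_{j>i,\ e_j\text{ even},\ e_j>0}(x^{e+\varepsilon_i-\varepsilon_j})^*.$$ $K_k(d)=\bigcap_{r>0}\ker\mathrm{Sq}^r_*\subseteq(\mathcal P_k^d)^*$, where $\mathrm{Sq}^r_*$ is the transpose of $\mathrm{Sq}^r:\mathcal P_k^{d-r}\to\mathcal P_k^d$. A monomial $x^b$ is a spike if each $b_i=2^{m_i}-1$ with $m_i\ge0$ an integer. The group $\mathrm{GL}(k,\mathbb F_2)$ acts on $\mathcal P_k$ by linear substitution of variables, commuting with the Steenrod squares, and hence acts on $(\mathcal P_k^d)^*$ and on $K_k(d)$ by the transpose action. The dual-spike module $J_k(d)$ is the $\mathbb F_2\mathrm{GL}(k,\mathbb F_2)$-submodule of $K_k(d)$ generated by the $(x^b)^*$ with $x^b$ a spike of degree $d$. *)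

theory Defs
  imports
    "HOL-Library.Poly_Mapping"
    "HOL-Library.Function_Algebras"
    "HOL-Library.Z2"
    "Jordan_Normal_Form.Matrix"
begin

section \<open>Polynomials over the field with two elements\<close>

text \<open>
  Exponent vectors are finitely supported functions on \<^typ>\<open>nat\<close>; the variables
  \<open>x\<^sub>1, \<dots>, x\<^sub>k\<close> correspond to the indices \<open>0, \<dots>, k - 1\<close>, in the same order.
  The field with two elements is \<^typ>\<open>bit\<close>.
\<close>

type_synonym expo = "nat \<Rightarrow>\<^sub>0 nat"
type_synonym poly2 = "expo \<Rightarrow>\<^sub>0 bit"

definition expo_deg :: "expo \<Rightarrow> nat" where
  "expo_deg e = (\<Sum>i\<in>Poly_Mapping.keys e. Poly_Mapping.lookup e i)"

definition expos :: "nat \<Rightarrow> nat \<Rightarrow> expo set" where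
  "expos k n = {e. Poly_Mapping.keys e \<subseteq> {..<k} \<and> expo_deg e = n}"

definition unit_expo :: "nat \<Rightarrow> expo" where
  "unit_expo i = Poly_Mapping.single i 1"

definition xmono :: "expo \<Rightarrow> poly2" where
  "xmono e = Poly_Mapping.single e 1"

definition pconst :: "bit \<Rightarrow> poly2" where
  "pconst c = Poly_Mapping.single 0 c"

definition hpolys :: "nat \<Rightarrow> nat \<Rightarrow> poly2 set" where
  "hpolys k n = {p. Poly_Mapping.keys p \<subseteq> expos k n}"

definition lin_ext :: "(expo \<Rightarrow> poly2) \<Rightarrow> poly2 \<Rightarrow> poly2" where
  "lin_ext g p = (\<Sum>e\<in>Poly_Mapping.keys p. pconst (Poly_Mapping.lookup p e) * g e)"

section \<open>Steenrod squares and the contraction\<close>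

definition Sq :: "nat \<Rightarrow> nat \<Rightarrow> poly2 \<Rightarrow> poly2" where
  "Sq k r = lin_ext (\<lambda>a. \<Sum>b\<in>expos k r.
     pconst (of_nat (\<Prod>i<k. Poly_Mapping.lookup a i choose Poly_Mapping.lookup b i)) * xmono (a + b))"

definition first_var :: "expo \<Rightarrow> nat" where
  "first_var e = (LEAST i. Poly_Mapping.lookup e i > 0)"

definition contraction :: "poly2 \<Rightarrow> poly2" where
  "contraction = lin_ext (\<lambda>e.
     if e \<noteq> 0 \<and> even (Poly_Mapping.lookup e (first_var e))
     then xmono (e - unit_expo (first_var e)) else 0)"

definition p_map :: "nat \<Rightarrow> poly2 \<Rightarrow> poly2" where
  "p_map k p = contraction (Sq k 1 p)"

section \<open>The matrix and its zero rows\<close>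

definition row_basis :: "nat \<Rightarrow> nat \<Rightarrow> expo set" where
  "row_basis k d = {e \<in> expos k d. odd (Poly_Mapping.lookup e (first_var e))}"

text \<open>The pair \<open>(t, g)\<close> labels the column of the image of \<open>Sq\<close> of index \<open>2 ^ t\<close> on \<open>x\<^sup>g\<close>.\<close>

definition column_labels :: "nat \<Rightarrow> nat \<Rightarrow> (nat \<times> expo) set" where
  "column_labels k d = {(t, g). t \<ge> 1 \<and> 2 ^ t \<le> d \<and> g \<in> expos k (d - 2 ^ t)}"

text \<open>
  The columns lie in the span of the monomials in \<^term>\<open>row_basis k d\<close>, so that the
  coordinates of a column are its coefficients at these monomials.
\<close>

definition Mbar :: "nat \<Rightarrow> expo \<Rightarrow> nat \<times> expo \<Rightarrow> bit" where
  "Mbar k e = (\<lambda>(t, g). Poly_Mapping.lookup (p_map k (Sq k (2 ^ t) (xmono g))) e)"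

definition zero_rows :: "nat \<Rightarrow> nat \<Rightarrow> expo set" where
  "zero_rows k d = {e \<in> row_basis k d. \<forall>c\<in>column_labels k d. Mbar k e c = 0}"

definition num_zero_rows :: "nat \<Rightarrow> nat \<Rightarrow> nat" where
  "num_zero_rows k d = card (zero_rows k d)"

section \<open>Dual spaces\<close>

text \<open>
  Linear functionals on a homogeneous component are represented by functions on all polynomials
  which vanish outside that component. Sums are pointwise.
\<close>

type_synonym functional = "poly2 \<Rightarrow> bit"

definition fscale :: "bit \<Rightarrow> functional \<Rightarrow> functional" where
  "fscale c f = (\<lambda>p. c * f p)"

global_interpretation functional: vector_space fscale
  by unfold_locales (auto simp: fscale_def fun_eq_iff algebra_simps)

definition dual_space :: "nat \<Rightarrow> nat \<Rightarrow> functional set" where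
  "dual_space k n = {f.
     (\<forall>p\<in>hpolys k n. \<forall>q\<in>hpolys k n. f (p + q) = f p + f q) \<and>
     (\<forall>c. \<forall>p\<in>hpolys k n. f (pconst c * p) = c * f p) \<and>
     (\<forall>p. p \<notin> hpolys k n \<longrightarrow> f p = 0)}"

definition dual_mono :: "nat \<Rightarrow> nat \<Rightarrow> expo \<Rightarrow> functional" where
  "dual_mono k d e = (\<lambda>p. if p \<in> hpolys k d then Poly_Mapping.lookup p e else 0)"

definition phi :: "nat \<Rightarrow> nat \<Rightarrow> expo \<Rightarrow> functional" where
  "phi k d e = dual_mono k d e +
     (\<Sum>j | first_var e < j \<and> j < k \<and> even (Poly_Mapping.lookup e j) \<and> Poly_Mapping.lookup e j > 0.
        dual_mono k d (e + unit_expo (first_var e) - unit_expo j))"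

text \<open>
  The guard \<open>r \<le> d\<close> accounts for truncated subtraction: for \<open>r > d\<close> the component of degree
  \<open>d - r\<close> is zero, and so is the transpose.
\<close>

definition Sq_dual :: "nat \<Rightarrow> nat \<Rightarrow> nat \<Rightarrow> functional \<Rightarrow> functional" where
  "Sq_dual k d r f = (\<lambda>p. if r \<le> d \<and> p \<in> hpolys k (d - r) then f (Sq k r p) else 0)"

definition Ker :: "nat \<Rightarrow> nat \<Rightarrow> functional set" where
  "Ker k d = {f \<in> dual_space k d. \<forall>r>0. Sq_dual k d r f = 0}"

section \<open>The action of the general linear group and the dual-spike module\<close>

definition GL2 :: "nat \<Rightarrow> bit mat set" where
  "GL2 k = {A \<in> carrier_mat k k. invertible_mat A}"

text \<open>The variable \<open>x\<^sub>j\<close> is replaced by the linear form given by column \<open>j\<close> of the matrix.\<close>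

definition lin_subst :: "nat \<Rightarrow> bit mat \<Rightarrow> poly2 \<Rightarrow> poly2" where
  "lin_subst k A = lin_ext (\<lambda>e. \<Prod>j<k.
     (\<Sum>i<k. pconst (A $$ (i, j)) * xmono (unit_expo i)) ^ Poly_Mapping.lookup e j)"

text \<open>
  Precomposition with the substitution is a right action; making it a left action by an inverse
  or a transpose of the matrix gives the same submodules, as the general linear group is closed
  under both.
\<close>

definition dual_act :: "nat \<Rightarrow> nat \<Rightarrow> bit mat \<Rightarrow> functional \<Rightarrow> functional" where
  "dual_act k d A f = (\<lambda>p. if p \<in> hpolys k d then f (lin_subst k A p) else 0)"

definition GL_submodule :: "nat \<Rightarrow> nat \<Rightarrow> functional set \<Rightarrow> bool" where
  "GL_submodule k d W \<longleftrightarrow> W \<subseteq> Ker k d \<and> functional.subspace W \<and>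
     (\<forall>A\<in>GL2 k. \<forall>f\<in>W. dual_act k d A f \<in> W)"

definition spikes :: "nat \<Rightarrow> nat \<Rightarrow> expo set" where
  "spikes k d = {b \<in> expos k d. \<forall>i<k. \<exists>m::nat. Poly_Mapping.lookup b i = 2 ^ m - 1}"

text \<open>
  The least submodule of \<^term>\<open>Ker k d\<close> containing the duals of the spikes. Membership in
  \<^term>\<open>Ker k d\<close> is stated explicitly, so that the definition does not rely on the existence
  of such a submodule \<open>W\<close>.
\<close>

definition dual_spike_module :: "nat \<Rightarrow> nat \<Rightarrow> functional set" where
  "dual_spike_module k d = {f \<in> Ker k d.
     \<forall>W. GL_submodule k d W \<and> dual_mono k d ` spikes k d \<subseteq> W \<longrightarrow> f \<in> W}"

end

theory Submission
  imports Defs "Jordan_Normal_Form.Gauss_Jordan_Elimination"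
begin

text \<open>
  Write \<open>i\<close> for the first variable of a row \<open>e\<close>. The functional \<^term>\<open>phi k d e\<close> is the row
  of \<^const>\<open>p_map\<close> at \<open>e\<close>: the monomials that \<open>Sq\<^sup>1\<close> followed by the contraction sends to
  something involving \<open>x\<^sup>e\<close> are \<open>x\<^sup>e\<close> itself and those obtained from it by moving one unit
  from an even positive exponent to \<open>i\<close> (\<open>lookup_p_map\<close>). So the entries of row \<open>e\<close> are the
  values of \<^term>\<open>phi k d e\<close> on the images of the squares of index \<open>2\<^sup>t\<close>, \<open>t \<ge> 1\<close>. As
  the matrix of these functionals on the monomials of the row basis is the identity, they are
  independent, which gives the dimension.

  For membership in the dual-spike module, the zero rows are determined by testing them on a few
  columns (\<open>zero_row_cases\<close>). Columns \<open>x\<^sup>g\<close> where \<open>g\<close> differs from \<open>e\<close> in a single exponent force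
  every exponent that is not even and positive to be of the form \<open>2\<^sup>m - 1\<close>. When an even positive
  exponent exists, the terms of \<^const>\<open>phi\<close> interact, and further columns force it to be \<open>2\<close>, the
  exponent of \<open>i\<close> to be \<open>1\<close>, and no second even positive exponent to occur. Hence either \<open>x\<^sup>e\<close> is
  a spike and \<^term>\<open>phi k d e\<close> is its dual, or, up to exponents of the form \<open>2\<^sup>m - 1\<close> in the other
  variables, \<^term>\<open>phi k d e\<close> is the sum of the duals of \<open>x\<^sub>i x\<^sub>j\<^sup>2\<close> and \<open>x\<^sub>i\<^sup>2 x\<^sub>j\<close>.

  In the second case the transvection \<open>x\<^sub>j \<mapsto> x\<^sub>i + x\<^sub>j\<close> takes the dual of \<open>x\<^sub>i\<^sup>3\<close> to the sum
  of the duals of the four monomials of degree \<open>3\<close> in \<open>x\<^sub>i, x\<^sub>j\<close>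
  (\<open>transvection_on_dual_mono\<close>); subtracting the duals of the spikes \<open>x\<^sub>i\<^sup>3\<close> and \<open>x\<^sub>j\<^sup>3\<close>
  leaves \<^term>\<open>phi k d e\<close>. That these functionals annihilate the image of every square of positive
  index is read off from the binomial coefficients (\<open>even_row_coeff\<close>).
\<close>

(* These rules would turn the ring operations on bits into Boolean ones, to which the laws for
   finite sums do not apply. *)
declare add_bit_eq_xor [simp del] mult_bit_eq_and [simp del]

section \<open>Parity of binomial coefficients\<close>

text \<open>
  Lucas' congruence modulo \<open>2\<close>, one binary digit at a time. Pascal's rule links the two parities of
  the upper index, so all four cases go through one induction together.
\<close>
lemma odd_binomial_double:
  "even ((2 * a) choose (2 * b + 1))"
  "odd ((2 * a) choose (2 * b)) \<longleftrightarrow> odd (a choose b)"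
  "odd ((2 * a + 1) choose (2 * b + 1)) \<longleftrightarrow> odd (a choose b)"
  "odd ((2 * a + 1) choose (2 * b)) \<longleftrightarrow> odd (a choose b)"
proof -
  have "(\<forall>b. even ((2 * a) choose (2 * b + 1)) \<and> (odd ((2 * a) choose (2 * b)) \<longleftrightarrow> odd (a choose b)))
    \<and> (\<forall>b. (odd ((2 * a + 1) choose (2 * b + 1)) \<longleftrightarrow> odd (a choose b)) \<and>
      (odd ((2 * a + 1) choose (2 * b)) \<longleftrightarrow> odd (a choose b)))" (is "?E a \<and> ?O a")
  proof (induction a)
    case 0
    have zero: "(0 choose b) = (if b = 0 then 1 else 0)" for b :: nat by (cases b) auto
    have "?E 0" by (simp add: zero)
    moreover have "?O 0"
    proof (intro allI conjI)
      fix b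
      show "odd ((2 * 0 + 1) choose (2 * b + 1)) \<longleftrightarrow> odd (0 choose b)" by (simp add: zero)
      show "odd ((2 * 0 + 1) choose (2 * b)) \<longleftrightarrow> odd (0 choose b)"
        by (cases "b = 0") (auto simp: binomial_eq_0 zero)
    qed
    ultimately show ?case ..
  next
    case (Suc a)
    have E: "?E (Suc a)"
    proof (intro allI conjI)
      fix b
      show "even ((2 * Suc a) choose (2 * b + 1))"
        using Suc by simp
      show "odd ((2 * Suc a) choose (2 * b)) \<longleftrightarrow> odd (Suc a choose b)"
      proof (cases b)
        case (Suc c)
        have "(2 * Suc a) choose (2 * b)
          = ((2 * a + 1) choose (2 * c + 1)) + ((2 * a + 1) choose (2 * Suc c))"
          by (simp add: Suc)
        then show ?thesis using \<open>?E a \<and> ?O a\<close> Suc by (metis binomial_Suc_Suc even_add)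
      qed simp
    qed
    have "?O (Suc a)"
    proof (intro allI conjI)
      fix b
      have "(2 * Suc a + 1) choose (2 * b + 1)
          = ((2 * Suc a) choose (2 * b)) + ((2 * Suc a) choose (2 * b + 1))"
        by simp
      then show "odd ((2 * Suc a + 1) choose (2 * b + 1)) \<longleftrightarrow> odd (Suc a choose b)"
        using E by (metis even_add)
      show "odd ((2 * Suc a + 1) choose (2 * b)) \<longleftrightarrow> odd (Suc a choose b)"
      proof (cases b)
        case (Suc c)
        have "(2 * Suc a + 1) choose (2 * b)
          = ((2 * Suc a) choose (2 * c + 1)) + ((2 * Suc a) choose (2 * b))"
          by (simp add: Suc)
        then show ?thesis using E by (metis even_add)
      qed simp
    qed
    with E show ?case ..
  qed
  then show "even ((2 * a) choose (2 * b + 1))"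
    "odd ((2 * a) choose (2 * b)) \<longleftrightarrow> odd (a choose b)"
    "odd ((2 * a + 1) choose (2 * b + 1)) \<longleftrightarrow> odd (a choose b)"
    "odd ((2 * a + 1) choose (2 * b)) \<longleftrightarrow> odd (a choose b)"
    by blast+
qed

text \<open>
  The binary digits of \<open>2\<^sup>m - 1 - c\<close> are complementary to those of \<open>c\<close>, so some digit of \<open>c\<close> is
  \<open>1\<close> where the other is \<open>0\<close>. This is the reason why spikes are never hit.
\<close>
lemma even_binomial_complement:
  assumes "0 < c" "c < 2 ^ m"
  shows "even ((2 ^ m - 1 - c) choose c)"
  using assms
proof (induction m arbitrary: c)
  case (Suc m)
  show ?case
  proof (cases "even c")
    case True
    then obtain b where b: "c = 2 * b" by blast
    with Suc.prems have bm: "0 < b" "b < 2 ^ m" by auto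
    then have "2 ^ Suc m - 1 - c = 2 * (2 ^ m - 1 - b) + 1" using b by auto
    then show ?thesis using Suc.IH[OF bm] odd_binomial_double(4) b by metis
  next
    case False
    then obtain b where b: "c = 2 * b + 1" using oddE by blast
    with Suc.prems have "2 ^ Suc m - 1 - c = 2 * (2 ^ m - 1 - b)" by auto
    then show ?thesis using odd_binomial_double(1) b by metis
  qed
qed simp

text \<open>
  Conversely, if the binary expansion of \<open>n\<close> has a zero digit \<open>t\<close> below a nonzero one, then \<open>n - 2\<^sup>t\<close>
  has digit \<open>1\<close> there. The induction strips the last digit: \<open>t = 0\<close> shows that it is \<open>1\<close>.
\<close>
lemma spike_if_not_hit:
  assumes "\<And>t. 2 ^ t \<le> n \<Longrightarrow> even ((n - 2 ^ t) choose 2 ^ t)"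
  shows "\<exists>m. n = 2 ^ m - (1::nat)"
  using assms
proof (induction n rule: less_induct)
  case (less n)
  show ?case
  proof (cases "n = 0")
    case True
    then show ?thesis by (intro exI[of _ 0]) simp
  next
    case False
    then have "even (n - 1)" using less.prems[of 0] by simp
    with False obtain u where u: "n = 2 * u + 1" by (metis One_nat_def Suc_pred' even_Suc neq0_conv oddE)
    have "\<exists>m. u = 2 ^ m - 1"
    proof (rule less.IH)
      show "u < n" using u by simp
      fix t :: nat assume t: "2 ^ t \<le> u"
      then have "even ((n - 2 ^ Suc t) choose 2 ^ Suc t)" using u by (intro less.prems) simp
      moreover have "n - 2 ^ Suc t = 2 * (u - 2 ^ t) + 1" using u t by auto
      ultimately show "even ((u - 2 ^ t) choose 2 ^ t)"
        by (metis odd_binomial_double(4) power_Suc)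
    qed
    then obtain m where "u = 2 ^ m - 1" ..
    moreover have "(2::nat) ^ m > 0" by simp
    ultimately have "n = 2 ^ Suc m - 1" using u by (simp only: power_Suc)
    then show ?thesis ..
  qed
qed

section \<open>Homogeneous polynomials\<close>

text \<open>
  The same name serves for exponents of monomials and coefficients of polynomials, both being
  finitely supported functions.
\<close>
abbreviation value_at :: "('a \<Rightarrow>\<^sub>0 'b::zero) \<Rightarrow> 'a \<Rightarrow> 'b" where "value_at \<equiv> Poly_Mapping.lookup"

lemma expo_deg_add: "expo_deg (a + b) = expo_deg a + expo_deg b"
  unfolding expo_deg_def
  by (rule setsum_keys_plus_distrib) simp_all

lemma expo_deg_unit [simp]: "expo_deg (unit_expo i) = 1"
  by (simp add: expo_deg_def unit_expo_def)

lemma keys_add_expo: "Poly_Mapping.keys (a + b) = Poly_Mapping.keys a \<union> Poly_Mapping.keys (b :: expo)"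
  by (auto simp: in_keys_iff lookup_add)

lemma unit_in_expos: "i < k \<Longrightarrow> unit_expo i \<in> expos k 1"
  by (simp add: expos_def) (simp add: unit_expo_def)

lemma add_in_expos: "a \<in> expos k m \<Longrightarrow> b \<in> expos k n \<Longrightarrow> a + b \<in> expos k (m + n)"
  by (auto simp: expos_def expo_deg_add keys_add_expo)

lemma diff_in_expos: "a + b \<in> expos k n \<Longrightarrow> b \<in> expos k m \<Longrightarrow> a \<in> expos k (n - m)"
  by (auto simp: expos_def expo_deg_add keys_add_expo)

lemma lookup_unit: "value_at (unit_expo i) j = (if i = j then 1 else 0)"
  by (simp add: unit_expo_def lookup_single when_def)

lemma lookup_le_expo_deg: "value_at e i \<le> expo_deg e"
proof (cases "i \<in> Poly_Mapping.keys e")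
  case True then show ?thesis unfolding expo_deg_def by (intro member_le_sum) auto
qed (simp add: in_keys_iff)

lemma expos_zero_outside: "e \<in> expos k n \<Longrightarrow> \<not> i < k \<Longrightarrow> value_at e i = 0"
  by (auto simp: expos_def in_keys_iff)

lemma finite_expos: "finite (expos k n)"
proof -
  have "value_at ` expos k n \<subseteq> {f. \<forall>i. (i \<in> {..<k} \<longrightarrow> f i \<in> {..n}) \<and> (i \<notin> {..<k} \<longrightarrow> f i = 0)}"
    using lookup_le_expo_deg by (auto simp: expos_zero_outside) (auto simp: expos_def)
  moreover have "finite \<dots>" by (rule finite_set_of_finite_funs) auto
  ultimately have "finite (value_at ` expos k n)" by (rule finite_subset)
  then show ?thesis by (rule finite_imageD) (auto intro!: inj_onI poly_mapping_eqI)
qed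

lemma lookup_pconst_mult: "value_at (pconst c * p) e = c * value_at p e"
  unfolding pconst_def mult_map_scale_conv_mult[symmetric] by (simp add: map.rep_eq when_def)

lemma lookup_xmono: "value_at (xmono a) e = (if a = e then 1 else 0)"
  by (simp add: xmono_def lookup_single when_def)

lemma xmono_mult: "xmono a * xmono b = xmono (a + b)"
  by (simp add: xmono_def mult_single)

lemma lookup_lin_ext:
  "value_at (lin_ext g p) e = (\<Sum>a\<in>Poly_Mapping.keys p. value_at p a * value_at (g a) e)"
  by (simp add: lin_ext_def lookup_sum lookup_pconst_mult)

lemma lin_ext_xmono: "lin_ext g (xmono a) = g a"
  by (rule poly_mapping_eqI) (simp add: lookup_lin_ext xmono_def)

lemma lin_ext_in_hpolys:
  assumes "p \<in> hpolys k m" "\<And>a. a \<in> expos k m \<Longrightarrow> g a \<in> hpolys k n"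
  shows "lin_ext g p \<in> hpolys k n"
  unfolding hpolys_def
proof safe
  fix e assume "e \<in> Poly_Mapping.keys (lin_ext g p)"
  then have "(\<Sum>a\<in>Poly_Mapping.keys p. value_at p a * value_at (g a) e) \<noteq> 0"
    by (simp add: in_keys_iff lookup_lin_ext)
  then obtain a where "a \<in> Poly_Mapping.keys p" "value_at (g a) e \<noteq> 0"
    by (rule sum.not_neutral_contains_not_neutral) auto
  then show "e \<in> expos k n" using assms(1) assms(2)[of a] unfolding hpolys_def
    by (metis (no_types, lifting) in_keys_iff mem_Collect_eq subsetD)
qed

lemma xmono_in_hpolys: "a \<in> expos k n \<Longrightarrow> xmono a \<in> hpolys k n"
  by (simp add: hpolys_def xmono_def)

lemma of_nat_bit_eq_0_iff: "of_nat n = (0::bit) \<longleftrightarrow> even n"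
  by (induction n) (auto simp: add_bit_eq_xor)

section \<open>Steenrod squares\<close>

text \<open>
  The guard is needed since the truncated difference would give the value \<open>1\<close> for \<open>m > n\<close>.
\<close>
definition hit_factor :: "nat \<Rightarrow> nat \<Rightarrow> nat" where
  "hit_factor m n = (if m \<le> n then m choose (n - m) else 0)"

text \<open>
  Modulo \<open>2\<close>, this is the coefficient of \<open>x\<^sup>c\<close> in the Steenrod square of \<open>x\<^sup>a\<close> of the only index that
  fits the degrees.
\<close>
definition hit_coeff :: "nat \<Rightarrow> expo \<Rightarrow> expo \<Rightarrow> nat" where
  "hit_coeff k a c = (\<Prod>i<k. hit_factor (value_at a i) (value_at c i))"

lemma lookup_Sq_xmono:
  assumes a: "a \<in> expos k n" and c: "c \<in> expos k (n + r)"
  shows "value_at (Sq k r (xmono a)) c = of_nat (hit_coeff k a c)"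
proof -
  have "value_at (Sq k r (xmono a)) c
    = (\<Sum>b\<in>expos k r. if a + b = c then of_nat (\<Prod>i<k. value_at a i choose value_at b i) else 0)"
    unfolding Sq_def lin_ext_xmono
    by (auto simp: lookup_sum lookup_pconst_mult lookup_xmono intro!: sum.cong)
  also have "\<dots> = of_nat (hit_coeff k a c)"
  proof (cases "\<forall>i<k. value_at a i \<le> value_at c i")
    case True
    have le: "value_at a i \<le> value_at c i" for i
      using True expos_zero_outside[OF a] by (cases "i < k") auto
    have ac: "a + (c - a) = c" by (rule poly_mapping_eqI) (simp add: lookup_add lookup_minus le)
    have iff: "a + b = c \<longleftrightarrow> c - a = b" for b using ac by (metis add_left_cancel)
    have "c - a \<in> expos k r"
      using diff_in_expos[of "c - a" a k "n + r" n] a c ac by (simp add: add.commute)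
    then show ?thesis
      using True by (simp add: iff finite_expos hit_coeff_def hit_factor_def lookup_minus)
  next
    case False
    then have "a + b \<noteq> c" for b by (auto simp: lookup_add)
    moreover have "hit_coeff k a c = 0" unfolding hit_coeff_def
      using False by (intro prod_zero) (auto simp: hit_factor_def)
    ultimately show ?thesis by simp
  qed
  finally show ?thesis .
qed

lemma Sq_xmono_in_hpolys: "a \<in> expos k n \<Longrightarrow> Sq k r (xmono a) \<in> hpolys k (n + r)"
  unfolding Sq_def lin_ext_xmono hpolys_def
proof safe
  fix c
  assume a: "a \<in> expos k n" and "c \<in> Poly_Mapping.keys (\<Sum>b\<in>expos k r.
     pconst (of_nat (\<Prod>i<k. value_at a i choose value_at b i)) * xmono (a + b))"
  then have "(\<Sum>b\<in>expos k r. of_nat (\<Prod>i<k. value_at a i choose value_at b i) *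
       (if a + b = c then 1 else 0::bit)) \<noteq> 0"
    by (simp add: in_keys_iff lookup_sum lookup_pconst_mult lookup_xmono)
  then obtain b where "b \<in> expos k r" "a + b = c"
    by (rule sum.not_neutral_contains_not_neutral) (auto split: if_splits)
  then show "c \<in> expos k (n + r)" using add_in_expos[OF a] by blast
qed

lemma Sq_eq_lin_ext: "Sq k r p = lin_ext (\<lambda>a. Sq k r (xmono a)) p"
  by (simp add: Sq_def lin_ext_xmono)

lemma Sq_in_hpolys: "p \<in> hpolys k n \<Longrightarrow> Sq k r p \<in> hpolys k (n + r)"
  by (subst Sq_eq_lin_ext, rule lin_ext_in_hpolys[of p k n]) (auto intro: Sq_xmono_in_hpolys)

lemma lookup_Sq:
  assumes p: "p \<in> hpolys k n" and c: "c \<in> expos k (n + r)"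
  shows "value_at (Sq k r p) c = (\<Sum>a\<in>Poly_Mapping.keys p. value_at p a * of_nat (hit_coeff k a c))"
proof (subst Sq_eq_lin_ext, unfold lookup_lin_ext, rule sum.cong[OF refl])
  fix a assume "a \<in> Poly_Mapping.keys p"
  then have "a \<in> expos k n" using p by (auto simp: hpolys_def)
  then show "value_at p a * value_at (Sq k r (xmono a)) c = value_at p a * of_nat (hit_coeff k a c)"
    by (simp add: lookup_Sq_xmono c)
qed

section \<open>The functionals as rows of the matrix\<close>

definition evens :: "nat \<Rightarrow> expo \<Rightarrow> nat set" where
  "evens k e = {j. first_var e < j \<and> j < k \<and> even (value_at e j) \<and> value_at e j > 0}"

definition shift :: "expo \<Rightarrow> nat \<Rightarrow> expo" where
  "shift e j = e + unit_expo (first_var e) - unit_expo j"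

lemma finite_evens: "finite (evens k e)"
  by (rule finite_subset[of _ "{..<k}"]) (auto simp: evens_def)

lemma lookup_shift:
  "j \<in> evens k e \<Longrightarrow> value_at (shift e j) n =
    (if n = first_var e then value_at e n + 1 else if n = j then value_at e n - 1 else value_at e n)"
  by (auto simp: shift_def evens_def lookup_minus lookup_add lookup_unit)

lemma first_var_eqI:
  assumes "value_at e i > 0" "\<And>n. n < i \<Longrightarrow> value_at e n = 0"
  shows "first_var e = i"
  unfolding first_var_def by (rule Least_equality) (use assms in \<open>auto intro: leI\<close>)

lemma before_first_var: "n < first_var e \<Longrightarrow> value_at e n = 0"
  using not_less_Least[of n "\<lambda>i. value_at e i > 0"] by (auto simp: first_var_def)

lemma row_basisD:
  assumes "e \<in> row_basis k d"
  shows "e \<in> expos k d" "odd (value_at e (first_var e))" "first_var e < k" "first_var e \<notin> evens k e"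
  using assms expos_zero_outside[of e k d "first_var e"]
  by (cases "first_var e < k"; auto simp: row_basis_def evens_def)+

lemma shift_in_expos:
  assumes e: "e \<in> row_basis k d" and j: "j \<in> evens k e"
  shows "shift e j \<in> expos k d"
proof -
  have "shift e j + unit_expo j = e + unit_expo (first_var e)"
    using j by (intro poly_mapping_eqI) (auto simp: lookup_add lookup_shift lookup_unit evens_def)
  moreover have "e + unit_expo (first_var e) \<in> expos k (d + 1)"
    using row_basisD[OF e] by (intro add_in_expos unit_in_expos)
  ultimately show ?thesis
    using diff_in_expos[of "shift e j" "unit_expo j" k "d + 1" 1] unit_in_expos[of j k] j
    by (simp add: evens_def)
qed

text \<open>
  The first variable is unchanged while its exponent becomes even. So the additional terms of
  \<^const>\<open>phi\<close> are invisible on the row basis.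
\<close>
lemma shift_notin_row_basis:
  assumes e: "e \<in> row_basis k d" and j: "j \<in> evens k e"
  shows "shift e j \<notin> row_basis k d"
proof -
  have "first_var (shift e j) = first_var e"
    by (rule first_var_eqI) (use j in \<open>auto simp: lookup_shift before_first_var evens_def\<close>)
  then show ?thesis using row_basisD(2)[OF e] j by (auto simp: row_basis_def lookup_shift)
qed

lemma sum_fun_apply: "(\<Sum>j\<in>S. f j) p = (\<Sum>j\<in>S. f j p)"
  for f :: "'a \<Rightarrow> 'b \<Rightarrow> 'c::comm_monoid_add"
  by (induction S rule: infinite_finite_induct) auto

lemma phi_apply:
  "p \<in> hpolys k d \<Longrightarrow> phi k d e p = value_at p e + (\<Sum>j\<in>evens k e. value_at p (shift e j))"
  by (simp add: phi_def dual_mono_def sum_fun_apply evens_def shift_def)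

lemma expos_1: "expos k 1 = unit_expo ` {..<k}"
proof
  show "unit_expo ` {..<k} \<subseteq> expos k 1" using unit_in_expos by auto
  show "expos k 1 \<subseteq> unit_expo ` {..<k}"
  proof
    fix e assume e: "e \<in> expos k 1"
    then have "e \<noteq> 0" by (auto simp: expos_def expo_deg_def)
    then obtain i where i: "value_at e i > 0"
      by (metis lookup_zero not_gr_zero poly_mapping_eqI)
    have e': "e = (e - unit_expo i) + unit_expo i"
      using i by (intro poly_mapping_eqI) (auto simp: lookup_minus lookup_add lookup_unit)
    then have "expo_deg (e - unit_expo i) = 0"
      using e expo_deg_add[of "e - unit_expo i" "unit_expo i"] by (simp add: expos_def)
    then have "e - unit_expo i = 0"
      using lookup_le_expo_deg[of "e - unit_expo i"] by (intro poly_mapping_eqI) simp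
    with e' have "e = unit_expo i" by simp
    moreover have "i < k" using i expos_zero_outside[OF e, of i] by (cases "i < k") auto
    ultimately show "e \<in> unit_expo ` {..<k}" by simp
  qed
qed

lemma lookup_Sq1_xmono:
  "value_at (Sq k 1 (xmono a)) c = (\<Sum>j<k. if a + unit_expo j = c then of_nat (value_at a j) else 0)"
proof -
  have inj: "inj_on unit_expo {..<k}"
    by (rule inj_onI) (metis lookup_unit zero_neq_one)
  have "(\<Prod>i<k. value_at a i choose value_at (unit_expo j) i) = value_at a j" if "j < k" for j
  proof -
    have "(\<Prod>i<k. value_at a i choose value_at (unit_expo j) i)
      = (\<Prod>i<k. if i = j then value_at a i else 1)"
      by (intro prod.cong) (auto simp: lookup_unit)
    then show ?thesis using that by simp
  qed
  then show ?thesis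
    unfolding Sq_def lin_ext_xmono expos_1
    by (auto simp: sum.reindex[OF inj] lookup_sum lookup_pconst_mult lookup_xmono
      simp del: of_nat_prod intro!: sum.cong)
qed

text \<open>
  \<open>Sq\<^sup>1\<close> is a derivation: raising the exponent of \<open>x\<^sub>j\<close> counts when that exponent was odd, that is,
  when it is even and positive afterwards.
\<close>
lemma lookup_Sq1:
  "value_at (Sq k 1 p) c = (\<Sum>j | j < k \<and> even (value_at c j) \<and> value_at c j > 0.
     value_at p (c - unit_expo j))"
proof -
  have "value_at (Sq k 1 p) c = (\<Sum>a\<in>Poly_Mapping.keys p. \<Sum>j<k.
      value_at p a * (if a + unit_expo j = c then of_nat (value_at a j) else 0))"
    by (subst Sq_eq_lin_ext) (simp only: lookup_lin_ext lookup_Sq1_xmono sum_distrib_left)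
  also have "\<dots> = (\<Sum>j<k. \<Sum>a\<in>Poly_Mapping.keys p.
      value_at p a * (if a + unit_expo j = c then of_nat (value_at a j) else 0))"
    by (rule sum.swap)
  also have "\<dots> = (\<Sum>j<k. if even (value_at c j) \<and> value_at c j > 0
      then value_at p (c - unit_expo j) else 0)"
  proof (rule sum.cong[OF refl])
    fix j
    have "(\<Sum>a\<in>Poly_Mapping.keys p. value_at p a * (if a + unit_expo j = c then of_nat (value_at a j) else 0))
      = (\<Sum>a\<in>Poly_Mapping.keys p. if a = c - unit_expo j then
          (if even (value_at c j) \<and> value_at c j > 0 then value_at p a else 0) else 0)"
    proof (rule sum.cong[OF refl])
      fix a
      have iff: "a + unit_expo j = c \<longleftrightarrow> a = c - unit_expo j \<and> value_at c j > 0"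
        by (auto simp: poly_mapping_eq_iff fun_eq_iff lookup_add lookup_minus lookup_unit)
      show "value_at p a * (if a + unit_expo j = c then of_nat (value_at a j) else 0)
        = (if a = c - unit_expo j then
          (if even (value_at c j) \<and> value_at c j > 0 then value_at p a else 0) else 0)"
      proof (cases "a + unit_expo j = c")
        case True
        then have "value_at c j = value_at a j + 1" by (auto simp: lookup_add lookup_unit)
        moreover have "of_nat (value_at a j) = (if even (value_at a j) then 0 else 1 :: bit)"
          using of_nat_bit_eq_0_iff[of "value_at a j"] by (auto simp: bit_not_zero_iff)
        ultimately show ?thesis using True iff by auto
      qed (use iff in auto)
    qed
    also have "\<dots> = (if even (value_at c j) \<and> value_at c j > 0 then value_at p (c - unit_expo j) else 0)"
      by (auto simp: sum.delta' in_keys_iff)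
    finally show "(\<Sum>a\<in>Poly_Mapping.keys p. value_at p a * (if a + unit_expo j = c then of_nat (value_at a j) else 0))
      = (if even (value_at c j) \<and> value_at c j > 0 then value_at p (c - unit_expo j) else 0)" .
  qed
  also have "\<dots> = (\<Sum>j | j < k \<and> even (value_at c j) \<and> value_at c j > 0. value_at p (c - unit_expo j))"
    by (subst sum.inter_filter[symmetric]) (auto intro!: sum.cong)
  finally show ?thesis .
qed

text \<open>
  The contraction lowers the first exponent from an even, positive value, hence from at least \<open>2\<close>;
  the first variable therefore stays the same and the step can be undone.
\<close>
lemma lookup_contraction:
  assumes e: "e \<in> row_basis k d"
  shows "value_at (contraction q) e = value_at q (e + unit_expo (first_var e))"
proof -
  let ?i = "first_var e"
  have iff: "a \<noteq> 0 \<and> even (value_at a (first_var a)) \<and> a - unit_expo (first_var a) = e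
    \<longleftrightarrow> a = e + unit_expo ?i" for a
  proof
    assume a: "a = e + unit_expo ?i"
    have "first_var a = ?i"
      by (rule first_var_eqI) (auto simp: a lookup_add lookup_unit before_first_var)
    moreover have ai: "value_at a ?i = value_at e ?i + 1" by (simp add: a lookup_add lookup_unit)
    moreover have "a \<noteq> 0" using ai by (metis add_is_0 lookup_zero zero_neq_one)
    ultimately show "a \<noteq> 0 \<and> even (value_at a (first_var a)) \<and> a - unit_expo (first_var a) = e"
      using a row_basisD(2)[OF e] by (auto intro!: poly_mapping_eqI simp: lookup_minus lookup_add)
  next
    assume a: "a \<noteq> 0 \<and> even (value_at a (first_var a)) \<and> a - unit_expo (first_var a) = e"
    have "\<exists>n. value_at a n > 0" using a by (metis lookup_zero not_gr_zero poly_mapping_eqI)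
    then have pos: "value_at a (first_var a) > 0" unfolding first_var_def by (rule LeastI_ex)
    with a have ge: "value_at a (first_var a) \<ge> 2" by (auto elim!: evenE)
    have e: "e = a - unit_expo (first_var a)" using a by simp
    have "?i = first_var a"
      by (rule first_var_eqI) (use ge in \<open>auto simp: e lookup_minus lookup_unit before_first_var\<close>)
    with e pos show "a = e + unit_expo ?i"
      by (intro poly_mapping_eqI) (auto simp: lookup_minus lookup_add lookup_unit)
  qed
  have "value_at (contraction q) e
    = (\<Sum>a\<in>Poly_Mapping.keys q. if a = e + unit_expo ?i then value_at q a else 0)"
    unfolding contraction_def lookup_lin_ext
    by (rule sum.cong[OF refl]) (auto simp: iff[symmetric] lookup_xmono)
  also have "\<dots> = value_at q (e + unit_expo ?i)" by (auto simp: in_keys_iff)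
  finally show ?thesis .
qed

text \<open>
  Combining the two previous descriptions, \<open>x\<^sup>e\<close> comes from \<open>x\<^sup>e x\<^sub>i\<close>, in which the even positive
  exponents are the one of \<open>i\<close>, giving back \<open>x\<^sup>e\<close>, and the even positive exponents of \<open>e\<close> after \<open>i\<close>.
\<close>
lemma lookup_p_map:
  assumes e: "e \<in> row_basis k d" and p: "p \<in> hpolys k d"
  shows "value_at (p_map k p) e = phi k d e p"
proof -
  let ?i = "first_var e" and ?c = "e + unit_expo (first_var e)"
  have "{j. j < k \<and> even (value_at ?c j) \<and> value_at ?c j > 0} = insert ?i (evens k e)"
    using row_basisD[OF e] before_first_var[of _ e]
    by (auto simp: lookup_add lookup_unit evens_def split: if_splits) (metis linorder_neqE_nat less_numeral_extra(3))+
  moreover have "?c - unit_expo ?i = e"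
    by (rule poly_mapping_eqI) (simp add: lookup_minus lookup_add)
  ultimately show ?thesis
    by (simp only: p_map_def lookup_contraction[OF e] lookup_Sq1 phi_apply[OF p]
      sum.insert[OF finite_evens row_basisD(4)[OF e]] shift_def)
qed

section \<open>The zero rows\<close>

text \<open>
  Modulo \<open>2\<close>, the value of \<^term>\<open>phi k d e\<close> on the square of \<open>x\<^sup>g\<close> that lands in degree \<open>d\<close>, see
  \<open>phi_Sq\<close>.
\<close>
definition row_coeff :: "nat \<Rightarrow> expo \<Rightarrow> expo \<Rightarrow> nat" where
  "row_coeff k e g = hit_coeff k g e + (\<Sum>j\<in>evens k e. hit_coeff k g (shift e j))"

lemma phi_Sq:
  assumes e: "e \<in> row_basis k d" and r: "r \<le> d" and p: "p \<in> hpolys k (d - r)"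
  shows "phi k d e (Sq k r p) = (\<Sum>a\<in>Poly_Mapping.keys p. value_at p a * of_nat (row_coeff k e a))"
proof -
  have d: "d = (d - r) + r" using r by simp
  have "Sq k r p \<in> hpolys k d" using Sq_in_hpolys[OF p, of r] r by simp
  moreover have "value_at (Sq k r p) c = (\<Sum>a\<in>Poly_Mapping.keys p. value_at p a * of_nat (hit_coeff k a c))"
    if "c \<in> expos k d" for c
    by (rule lookup_Sq[OF p]) (use that d in simp)
  moreover have "(\<Sum>j\<in>evens k e. \<Sum>a\<in>Poly_Mapping.keys p. value_at p a * of_nat (hit_coeff k a (shift e j)))
    = (\<Sum>a\<in>Poly_Mapping.keys p. \<Sum>j\<in>evens k e. value_at p a * of_nat (hit_coeff k a (shift e j)))"
    by (rule sum.swap)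
  ultimately show ?thesis
    using row_basisD(1)[OF e] shift_in_expos[OF e]
    by (simp add: phi_apply row_coeff_def sum.distrib sum_distrib_left distrib_left)
qed

text \<open>
  The test applied below: columns are produced by lowering some monomial \<open>x\<^sup>c\<close> of degree \<open>d\<close>, which
  will be \<open>x\<^sup>e\<close> or one of the other terms of \<^term>\<open>phi k d e\<close>.
\<close>
lemma zero_row_even:
  assumes e: "e \<in> zero_rows k d" and t: "t \<ge> 1" and b: "b \<in> expos k (2 ^ t)"
    and c: "c \<in> expos k d" and le: "\<And>n. value_at b n \<le> value_at c n"
  shows "even (row_coeff k e (c - b))"
proof -
  have eb: "e \<in> row_basis k d" using e by (simp add: zero_rows_def)
  have cb: "(c - b) + b = c" using le by (intro poly_mapping_eqI) (simp add: lookup_add lookup_minus)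
  have g: "c - b \<in> expos k (d - 2 ^ t)" using diff_in_expos[of "c - b" b] b c cb by simp
  have td: "2 ^ t \<le> d" using expo_deg_add[of "c - b" b] b c cb by (simp add: expos_def)
  have "(t, c - b) \<in> column_labels k d" using t g td by (simp add: column_labels_def)
  with e have "Mbar k e (t, c - b) = 0" by (auto simp: zero_rows_def)
  then have "phi k d e (Sq k (2 ^ t) (xmono (c - b))) = 0"
    using lookup_p_map[OF eb, of "Sq k (2 ^ t) (xmono (c - b))"] Sq_xmono_in_hpolys[OF g, of "2 ^ t"] td
    by (simp add: Mbar_def)
  then show ?thesis
    using phi_Sq[OF eb td xmono_in_hpolys[OF g]] by (simp add: xmono_def of_nat_bit_eq_0_iff)
qed

lemma hit_factor_diff: "r \<le> n \<Longrightarrow> hit_factor (n - r) n = (n - r) choose r"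
  by (simp add: hit_factor_def)

lemma hit_coeff_eq_prod:
  assumes "S \<subseteq> {..<k}" "\<And>n. n < k \<Longrightarrow> n \<notin> S \<Longrightarrow> value_at g n = value_at c n"
  shows "hit_coeff k g c = (\<Prod>n\<in>S. hit_factor (value_at g n) (value_at c n))"
  unfolding hit_coeff_def
  by (rule prod.mono_neutral_right) (use assms in \<open>auto simp: hit_factor_def\<close>)

lemma hit_coeff_eq_0: "n < k \<Longrightarrow> value_at c n < value_at g n \<Longrightarrow> hit_coeff k g c = 0"
  unfolding hit_coeff_def by (rule prod_zero) (auto simp: hit_factor_def intro!: bexI[of _ n])

text \<open>
  Squares do not lower exponents, while the term of \<^const>\<open>phi\<close> at \<open>j\<close> has a smaller exponent at \<open>j\<close>
  than \<open>e\<close>. So it can be hit from \<open>x\<^sup>g\<close> only if \<open>g\<close> differs from \<open>e\<close> at \<open>j\<close>.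
\<close>
lemma row_coeff_restrict:
  assumes "S \<subseteq> evens k e" "\<And>j. j \<in> evens k e \<Longrightarrow> j \<notin> S \<Longrightarrow> value_at g j = value_at e j"
  shows "row_coeff k e g = hit_coeff k g e + (\<Sum>j\<in>S. hit_coeff k g (shift e j))"
proof -
  have "(\<Sum>j\<in>evens k e. hit_coeff k g (shift e j)) = (\<Sum>j\<in>S. hit_coeff k g (shift e j))"
  proof (rule sum.mono_neutral_right[OF finite_evens assms(1)], safe)
    fix j assume j: "j \<in> evens k e" "j \<notin> S"
    show "hit_coeff k g (shift e j) = 0"
      by (rule hit_coeff_eq_0[of j]) (use j assms(2)[OF j] in \<open>auto simp: lookup_shift\<close>, auto simp: evens_def)
  qed
  then show ?thesis by (simp add: row_coeff_def)
qed

lemma single_in_expos: "l < k \<Longrightarrow> Poly_Mapping.single l n \<in> expos k n"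
  by (auto simp: expos_def expo_deg_def)

text \<open>
  Lowering \<open>e\<close> at \<open>l\<close> alone leaves all terms of \<^const>\<open>phi\<close> but \<open>x\<^sup>e\<close> out of reach, so
  \<open>spike_if_not_hit\<close> applies to the exponent at \<open>l\<close>. Since there is no column for \<open>t = 0\<close>, the
  oddness of the exponent comes from the assumption that \<open>l\<close> is not among the even ones.
\<close>
lemma zero_row_off_evens:
  assumes e: "e \<in> zero_rows k d" and l: "l < k" "l \<notin> evens k e"
  shows "\<exists>m. value_at e l = 2 ^ m - 1"
proof (rule spike_if_not_hit)
  have eb: "e \<in> row_basis k d" using e by (simp add: zero_rows_def)
  fix t :: nat assume t: "2 ^ t \<le> value_at e l"
  show "even ((value_at e l - 2 ^ t) choose 2 ^ t)"
  proof (cases "t = 0")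
    case True
    with t have "value_at e l > 0" by simp
    then have "\<not> l < first_var e" using before_first_var by fastforce
    then have "odd (value_at e l)"
      using l \<open>value_at e l > 0\<close> row_basisD(2)[OF eb] by (cases "l = first_var e") (auto simp: evens_def)
    with True show ?thesis by simp
  next
    case False
    let ?g = "e - Poly_Mapping.single l (2 ^ t)"
    have "even (row_coeff k e ?g)"
      by (rule zero_row_even[OF e, of t])
        (use False l t row_basisD[OF eb] in \<open>auto simp: single_in_expos lookup_single when_def\<close>)
    moreover have "row_coeff k e ?g = hit_coeff k ?g e + (\<Sum>j\<in>{}. hit_coeff k ?g (shift e j))"
      by (rule row_coeff_restrict) (use l in \<open>auto simp: lookup_minus lookup_single when_def\<close>)
    moreover have "hit_coeff k ?g e = (\<Prod>n\<in>{l}. hit_factor (value_at ?g n) (value_at e n))"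
      by (rule hit_coeff_eq_prod) (use l in \<open>auto simp: lookup_minus lookup_single when_def\<close>)
    ultimately show ?thesis using t by (simp add: lookup_minus hit_factor_def)
  qed
qed

text \<open>
  The bounds on the even exponents and on the first one come from \<open>Sq\<^sup>2\<close>, which hits \<open>x\<^sup>n\<close> from \<open>x\<^bsup>n-2\<^esup>\<close> when \<open>4\<close> divides \<open>n\<close>.
\<close>
lemma odd_binomial_2:
  assumes "4 dvd n" "n > 0"
  shows "odd ((n - 2) choose 2)"
proof -
  obtain u where u: "n = 4 * u" using assms by blast
  with assms have "n - 2 = 2 * (2 * u - 1)" "odd (2 * u - 1)" by auto
  then show ?thesis using odd_binomial_double(2)[of "2 * u - 1" 1] by simp
qed

lemma four_dvd_power_2: "n = 2 ^ m \<Longrightarrow> n > 2 \<Longrightarrow> 4 dvd (n::nat)"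
  using le_imp_power_dvd[of 2 m "2::nat"] by (cases "m \<ge> 2") (auto simp: not_le less_2_cases_iff)

text \<open>
  Lowering the term of \<^const>\<open>phi\<close> at \<open>l\<close> instead of \<open>x\<^sup>e\<close> shows that the exponent at \<open>l\<close>, less one,
  is a spike exponent; so the exponent is a power of \<open>2\<close>. If it were divisible by \<open>4\<close>, then \<open>Sq\<^sup>2\<close>
  would hit \<open>x\<^sup>e\<close>, whereas the term at \<open>l\<close> would be hit with an even coefficient.
\<close>
lemma zero_row_evens_eq_2:
  assumes e: "e \<in> zero_rows k d" and l: "l \<in> evens k e"
  shows "value_at e l = 2"
proof -
  have eb: "e \<in> row_basis k d" using e by (simp add: zero_rows_def)
  note i = row_basisD[OF eb]
  have lk: "l < k" "first_var e < l" and el: "even (value_at e l)" "value_at e l > 0"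
    using l by (auto simp: evens_def)
  have "\<exists>m. value_at e l - 1 = 2 ^ m - 1"
  proof (rule spike_if_not_hit)
    fix t :: nat assume t: "2 ^ t \<le> value_at e l - 1"
    show "even ((value_at e l - 1 - 2 ^ t) choose 2 ^ t)"
    proof (cases "t = 0")
      case True
      then show ?thesis using el by simp
    next
      case False
      let ?g = "shift e l - Poly_Mapping.single l (2 ^ t)"
      have "even (row_coeff k e ?g)"
        by (rule zero_row_even[OF e, of t])
          (use False l lk t shift_in_expos[OF eb l] in \<open>auto simp: single_in_expos lookup_single when_def lookup_shift\<close>)
      moreover have "row_coeff k e ?g = hit_coeff k ?g e + (\<Sum>j\<in>{l}. hit_coeff k ?g (shift e j))"
        by (rule row_coeff_restrict)
          (use l i(4) in \<open>auto simp: lookup_minus lookup_single when_def lookup_shift\<close>)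
      moreover have "hit_coeff k ?g e = 0"
        by (rule hit_coeff_eq_0[of "first_var e"])
          (use l lk i in \<open>auto simp: lookup_minus lookup_single when_def lookup_shift\<close>)
      moreover have "hit_coeff k ?g (shift e l) = (\<Prod>n\<in>{l}. hit_factor (value_at ?g n) (value_at (shift e l) n))"
        by (rule hit_coeff_eq_prod) (use lk in \<open>auto simp: lookup_minus lookup_single when_def\<close>)
      moreover have "value_at ?g l = value_at e l - 1 - 2 ^ t" "value_at (shift e l) l = value_at e l - 1"
        using l lk by (auto simp: lookup_minus lookup_shift)
      ultimately show ?thesis using hit_factor_diff[OF t] by simp
    qed
  qed
  then obtain m where "value_at e l - 1 = 2 ^ m - 1" ..
  then have m: "value_at e l = 2 ^ m" using el(2) by (metis Suc_pred' One_nat_def zero_less_numeral zero_less_power)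
  show ?thesis
  proof (rule ccontr)
    assume "value_at e l \<noteq> 2"
    then have gt: "value_at e l > 2" using el by (metis One_nat_def Suc_lessI nat_neq_iff numeral_2_eq_2 odd_one)
    then have four: "4 dvd value_at e l" using m four_dvd_power_2 by blast
    \<comment> \<open>The column for \<open>t = 1\<close>; its second summand is odd times \<open>e\<^sub>l - 2\<close>, hence even.\<close>
    let ?g = "e - Poly_Mapping.single l 2"
    have "even (row_coeff k e ?g)"
      by (rule zero_row_even[OF e, of 1])
        (use lk gt i(1) in \<open>auto simp: single_in_expos[of l k 2, simplified] lookup_single when_def\<close>)
    moreover have "row_coeff k e ?g = hit_coeff k ?g e + (\<Sum>j\<in>{l}. hit_coeff k ?g (shift e j))"
      by (rule row_coeff_restrict) (use l in \<open>auto simp: lookup_minus lookup_single when_def\<close>)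
    moreover have "hit_coeff k ?g e = (\<Prod>n\<in>{l}. hit_factor (value_at ?g n) (value_at e n))"
      by (rule hit_coeff_eq_prod) (use lk in \<open>auto simp: lookup_minus lookup_single when_def\<close>)
    moreover have "hit_coeff k ?g (shift e l)
        = (\<Prod>n\<in>{first_var e, l}. hit_factor (value_at ?g n) (value_at (shift e l) n))"
      by (rule hit_coeff_eq_prod) (use lk l i in \<open>auto simp: lookup_minus lookup_single when_def lookup_shift\<close>)
    moreover have "value_at ?g l = value_at e l - 2" "value_at (shift e l) l = value_at e l - 1"
      using l lk by (auto simp: lookup_minus lookup_shift)
    moreover have "hit_factor (value_at e l - 2) (value_at e l - 1) = value_at e l - 2"
      using gt by (simp add: hit_factor_def Suc_diff_Suc numeral_2_eq_2)
    moreover have "hit_factor (value_at e l - 2) (value_at e l) = (value_at e l - 2) choose 2"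
      using gt by (simp add: hit_factor_def)
    ultimately have "even ((value_at e l - 2) choose 2)" using lk el by auto
    then show False using odd_binomial_2[OF four el(2)] by simp
  qed
qed

text \<open>
  If the odd exponent \<open>2\<^sup>m - 1\<close> of the first variable is larger than \<open>1\<close>, then it is raised to a
  multiple of \<open>4\<close> in the term of \<^const>\<open>phi\<close> at \<open>l\<close>, which is then hit by \<open>Sq\<^sup>2\<close> in this variable.
\<close>
lemma zero_row_first_eq_1:
  assumes e: "e \<in> zero_rows k d" and l: "l \<in> evens k e"
  shows "value_at e (first_var e) = 1"
proof (rule ccontr)
  let ?i = "first_var e"
  assume ne: "value_at e ?i \<noteq> 1"
  have eb: "e \<in> row_basis k d" using e by (simp add: zero_rows_def)
  note i = row_basisD[OF eb]
  have lk: "l < k" "?i < l" using l by (auto simp: evens_def)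
  obtain m where "value_at e ?i = 2 ^ m - 1" using zero_row_off_evens[OF e i(3,4)] ..
  then have m: "value_at e ?i + 1 = 2 ^ m" by simp
  have gt: "value_at e ?i > 2" using ne i(2) by (metis One_nat_def Suc_lessI even_Suc gr0I numeral_2_eq_2 odd_one even_zero)
  then have four: "4 dvd value_at e ?i + 1" using m four_dvd_power_2 by auto
  let ?g = "shift e l - Poly_Mapping.single ?i 2"
  have e2: "value_at e l = 2" by (rule zero_row_evens_eq_2[OF e l])
  have g: "value_at ?g ?i = value_at e ?i - 1" "value_at ?g l = 1"
    using l lk e2 by (auto simp: lookup_minus lookup_shift lookup_single when_def)
  have "even (row_coeff k e ?g)"
    by (rule zero_row_even[OF e, of 1])
      (use i gt l shift_in_expos[OF eb l] in \<open>auto simp: single_in_expos[of _ k 2, simplified] lookup_single when_def lookup_shift\<close>)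
  moreover have "row_coeff k e ?g = hit_coeff k ?g e + (\<Sum>j\<in>{l}. hit_coeff k ?g (shift e j))"
    by (rule row_coeff_restrict)
      (use l i(4) in \<open>auto simp: lookup_minus lookup_single when_def lookup_shift\<close>)
  moreover have "hit_coeff k ?g e = (\<Prod>n\<in>{?i, l}. hit_factor (value_at ?g n) (value_at e n))"
    by (rule hit_coeff_eq_prod) (use lk l i in \<open>auto simp: lookup_minus lookup_single when_def lookup_shift\<close>)
  moreover have "hit_coeff k ?g (shift e l)
      = (\<Prod>n\<in>{?i}. hit_factor (value_at ?g n) (value_at (shift e l) n))"
    by (rule hit_coeff_eq_prod) (use lk l i in \<open>auto simp: lookup_minus lookup_single when_def lookup_shift\<close>)
  moreover have "hit_factor (value_at e ?i - 1) (value_at e ?i) = value_at e ?i - 1"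
    using gt by (simp add: hit_factor_def)
  moreover have "hit_factor (value_at e ?i - 1) (value_at (shift e l) ?i) = (value_at e ?i + 1 - 2) choose 2"
    using gt l by (simp add: hit_factor_def lookup_shift)
  ultimately have "even ((value_at e ?i + 1 - 2) choose 2)" using lk i(2) by (auto simp: g)
  then show False using odd_binomial_2[OF four] by simp
qed

text \<open>
  With two even exponents \<open>2\<close>, lower both by one. Then \<open>Sq\<^sup>2\<close> hits exactly three terms of
  \<^const>\<open>phi\<close>, namely \<open>x\<^sup>e\<close> and those at \<open>l\<close> and \<open>l'\<close>, and three is odd.
\<close>
lemma zero_row_evens_unique:
  assumes e: "e \<in> zero_rows k d" and l: "l \<in> evens k e" and l': "l' \<in> evens k e"
  shows "l = l'"
proof (rule ccontr)
  assume ne: "l \<noteq> l'"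
  let ?i = "first_var e"
  have eb: "e \<in> row_basis k d" using e by (simp add: zero_rows_def)
  note i = row_basisD[OF eb]
  have lk: "l < k" "?i < l" "l' < k" "?i < l'" using l l' by (auto simp: evens_def)
  have v: "value_at e l = 2" "value_at e l' = 2" "value_at e ?i = 1"
    using zero_row_evens_eq_2[OF e] zero_row_first_eq_1[OF e] l l' by auto
  let ?b = "unit_expo l + unit_expo l'"
  let ?g = "e - ?b"
  have g: "value_at ?g ?i = 1" "value_at ?g l = 1" "value_at ?g l' = 1"
    using lk ne v by (auto simp: lookup_minus lookup_add lookup_unit)
  have b: "?b \<in> expos k (2 ^ 1)" using add_in_expos[OF unit_in_expos[OF lk(1)] unit_in_expos[OF lk(3)]]
    by (simp add: numeral_2_eq_2)
  have one: "hit_coeff k ?g (shift e j) = 1" if "j \<in> {l, l'}" for j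
  proof -
    have j: "j \<in> evens k e" using that l l' by auto
    have "hit_coeff k ?g (shift e j)
      = (\<Prod>n\<in>{?i, l, l'}. hit_factor (value_at ?g n) (value_at (shift e j) n))"
      by (rule hit_coeff_eq_prod)
        (use lk that i j in \<open>auto simp: lookup_minus lookup_add lookup_unit lookup_shift\<close>)
    also have "\<dots> = 1"
      using lk ne that v by (auto simp: g lookup_shift[OF j] hit_factor_def)
    finally show ?thesis .
  qed
  have "even (row_coeff k e ?g)"
    by (rule zero_row_even[OF e _ b i(1)]) (use ne v in \<open>auto simp: lookup_add lookup_unit\<close>)
  moreover have "row_coeff k e ?g = hit_coeff k ?g e + (\<Sum>j\<in>{l, l'}. hit_coeff k ?g (shift e j))"
    by (rule row_coeff_restrict) (use l l' in \<open>auto simp: lookup_minus lookup_add lookup_unit\<close>)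
  moreover have "hit_coeff k ?g e = (\<Prod>n\<in>{l, l'}. hit_factor (value_at ?g n) (value_at e n))"
    by (rule hit_coeff_eq_prod) (use lk in \<open>auto simp: lookup_minus lookup_add lookup_unit\<close>)
  ultimately show False using ne one by (simp add: g v hit_factor_def)
qed

lemma zero_row_cases:
  assumes e: "e \<in> zero_rows k d"
  obtains (spike) "e \<in> spikes k d" "evens k e = {}"
  | (mixed) j where "evens k e = {j}" "value_at e (first_var e) = 1" "value_at e j = 2"
      "\<And>l. l < k \<Longrightarrow> l \<noteq> j \<Longrightarrow> \<exists>m. value_at e l = 2 ^ m - 1"
proof (cases "evens k e = {}")
  case True
  have "e \<in> expos k d" using e by (auto simp: zero_rows_def row_basis_def)
  with True zero_row_off_evens[OF e] show ?thesis by (intro spike) (auto simp: spikes_def)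
next
  case False
  then obtain j where j: "j \<in> evens k e" by blast
  then have "evens k e = {j}" using zero_row_evens_unique[OF e] by blast
  then show ?thesis
    using mixed zero_row_off_evens[OF e] zero_row_evens_eq_2[OF e j] zero_row_first_eq_1[OF e j] by blast
qed

section \<open>The functionals of zero rows lie in the kernel\<close>

lemma even_hit_factor:
  assumes "a \<noteq> 2 ^ m - 1"
  shows "even (hit_factor a (2 ^ m - 1))"
proof (cases "a \<le> 2 ^ m - 1")
  case True
  define c where "c = 2 ^ m - 1 - a"
  have "a = 2 ^ m - 1 - c" using True by (simp add: c_def)
  moreover have "0 < c" "c < 2 ^ m" using True assms by (auto simp: c_def intro: le_less_trans[of _ "2 ^ m - 1"])
  ultimately show ?thesis
    using even_binomial_complement[of c m] by (simp add: hit_factor_def)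
qed (simp add: hit_factor_def)

lemma even_hit_coeff:
  assumes "n < k" "value_at c n = 2 ^ m - 1" "value_at a n \<noteq> value_at c n"
  shows "even (hit_coeff k a c)"
proof -
  have "hit_factor (value_at a n) (value_at c n) dvd hit_coeff k a c"
    unfolding hit_coeff_def using assms(1) by (intro dvd_prodI) auto
  then show ?thesis using even_hit_factor[of "value_at a n" m] assms dvd_trans by metis
qed

lemma eq_if_in_expos:
  assumes "a \<in> expos k m" "c \<in> expos k n" "\<And>i. i < k \<Longrightarrow> value_at a i = value_at c i"
  shows "a = c"
  using assms expos_zero_outside by (intro poly_mapping_eqI) metis

text \<open>
  A difference at an exponent \<open>2\<^sup>m - 1\<close> common to the terms of \<^const>\<open>phi\<close> kills everything. What
  remains is the pair of exponents \<open>(1, 2)\<close> and its swap: only \<open>x\<^sub>i x\<^sub>j\<close> hits one of these from a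
  lower degree, and it hits both, so that the two contributions cancel.
\<close>
lemma even_row_coeff:
  assumes e: "e \<in> zero_rows k d" and a: "a \<in> expos k n" and n: "n \<noteq> d"
  shows "even (row_coeff k e a)"
proof -
  have eb: "e \<in> row_basis k d" using e by (simp add: zero_rows_def)
  note i = row_basisD[OF eb]
  have neq: "\<exists>l<k. value_at a l \<noteq> value_at c l" if "c \<in> expos k d" for c
    using eq_if_in_expos[OF a that] a that n by (auto simp: expos_def)
  from e show ?thesis
  proof (cases rule: zero_row_cases)
    case spike
    then show ?thesis
      using neq[OF i(1)] even_hit_coeff[of _ k e _ a] by (auto simp: row_coeff_def spikes_def)
  next
    case (mixed j)
    let ?i = "first_var e"
    have j: "j \<in> evens k e" "j < k" "?i < j" using mixed(1) by (auto simp: evens_def)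
    have row: "row_coeff k e a = hit_coeff k a e + hit_coeff k a (shift e j)"
      using mixed(1) by (simp add: row_coeff_def)
    show ?thesis
    proof (cases "\<exists>l<k. l \<notin> {?i, j} \<and> value_at a l \<noteq> value_at e l")
      case True
      then obtain l where l: "l < k" "l \<noteq> ?i" "l \<noteq> j" "value_at a l \<noteq> value_at e l" by blast
      obtain m where m: "value_at e l = 2 ^ m - 1" using mixed(4)[OF l(1,3)] ..
      then have "even (hit_coeff k a e)" using even_hit_coeff l by blast
      moreover have "even (hit_coeff k a (shift e j))"
        by (rule even_hit_coeff[OF l(1), of _ m]) (use l m j in \<open>auto simp: lookup_shift\<close>)
      ultimately show ?thesis by (simp add: row)
    next
      case False
      have "hit_coeff k a e = (\<Prod>l\<in>{?i, j}. hit_factor (value_at a l) (value_at e l))"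
        by (rule hit_coeff_eq_prod) (use False i j in auto)
      then have 1: "hit_coeff k a e = hit_factor (value_at a ?i) 1 * hit_factor (value_at a j) 2"
        using j mixed by simp
      have "hit_coeff k a (shift e j) = (\<Prod>l\<in>{?i, j}. hit_factor (value_at a l) (value_at (shift e j) l))"
        by (rule hit_coeff_eq_prod) (use False i j in \<open>auto simp: lookup_shift\<close>)
      then have 2: "hit_coeff k a (shift e j) = hit_factor (value_at a ?i) 2 * hit_factor (value_at a j) 1"
        using j mixed by (simp add: lookup_shift[OF j(1)] numeral_2_eq_2)
      have "\<not> (value_at a ?i = 1 \<and> value_at a j = 2)"
        using neq[OF i(1)] False mixed by auto
      moreover have "\<not> (value_at a ?i = 2 \<and> value_at a j = 1)"
        using neq[OF shift_in_expos[OF eb j(1)]] False mixed j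
        by (auto simp: lookup_shift[OF j(1)] split: if_splits)
      moreover have "hit_factor m 1 = (if m = 1 then 1 else 0)" for m
        by (cases m) (auto simp: hit_factor_def)
      moreover have "hit_factor m 2 = (if m = 1 \<or> m = 2 then 1 else 0)" for m
        by (cases m; cases "m - 1"; cases "m - 2") (auto simp: hit_factor_def)
      ultimately show ?thesis by (auto simp: row 1 2)
    qed
  qed
qed

lemma phi_in_dual_space: "e \<in> row_basis k d \<Longrightarrow> phi k d e \<in> dual_space k d"
proof -
  have "p + q \<in> hpolys k d" if "p \<in> hpolys k d" "q \<in> hpolys k d" for p q
    using that Poly_Mapping.keys_add[of p q] by (auto simp: hpolys_def)
  moreover have "pconst c * p \<in> hpolys k d" if "p \<in> hpolys k d" for p c
    using that by (auto simp: hpolys_def in_keys_iff lookup_pconst_mult)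
  moreover have "phi k d e p = 0" if "p \<notin> hpolys k d" for p
    using that by (simp add: phi_def dual_mono_def sum_fun_apply)
  ultimately show ?thesis
    by (simp add: dual_space_def phi_apply lookup_add lookup_pconst_mult sum.distrib
        sum_distrib_left distrib_left add_ac)
qed

lemma Ker_iff: "f \<in> Ker k d \<longleftrightarrow> f \<in> dual_space k d \<and>
  (\<forall>r p. 0 < r \<longrightarrow> r \<le> d \<longrightarrow> p \<in> hpolys k (d - r) \<longrightarrow> f (Sq k r p) = 0)"
  by (auto simp: Ker_def Sq_dual_def fun_eq_iff)

lemma phi_in_Ker:
  assumes e: "e \<in> zero_rows k d"
  shows "phi k d e \<in> Ker k d"
proof -
  have eb: "e \<in> row_basis k d" using e by (simp add: zero_rows_def)
  have "phi k d e (Sq k r p) = 0" if r: "0 < r" "r \<le> d" and p: "p \<in> hpolys k (d - r)" for r p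
  proof -
    have "of_nat (row_coeff k e a) = (0::bit)" if "a \<in> Poly_Mapping.keys p" for a
      using even_row_coeff[OF e, of a "d - r"] p that r by (auto simp: of_nat_bit_eq_0_iff hpolys_def)
    then show ?thesis by (simp add: phi_Sq[OF eb r(2) p])
  qed
  then show ?thesis using phi_in_dual_space[OF eb] by (simp add: Ker_iff)
qed

section \<open>Transvections acting on dual monomials\<close>

text \<open>
  In characteristic two a transvection is its own inverse.
\<close>
lemma addrow_in_GL2:
  assumes "i < k" "j < k" "i \<noteq> j"
  shows "addrow_mat k 1 i j \<in> GL2 k"
proof -
  have "inverts_mat (addrow_mat k 1 i j) (addrow_mat k (1::bit) i j)"
    using addrow_mat_inv[OF assms, of "1::bit"] by (simp add: inverts_mat_def)
  then show ?thesis unfolding GL2_def invertible_mat_def square_mat.simps by auto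
qed

lemma xmono_unit_power: "xmono (unit_expo i) ^ n = xmono (Poly_Mapping.single i n)"
proof (induction n)
  case 0 show ?case by (simp add: xmono_def)
next
  case (Suc n)
  then show ?case by (simp add: xmono_mult unit_expo_def single_add[symmetric])
qed

lemma prod_xmono: "finite S \<Longrightarrow> (\<Prod>l\<in>S. xmono (f l)) = xmono (\<Sum>l\<in>S. f l)"
proof (induction S rule: finite_induct)
  case empty show ?case by (simp add: xmono_def)
qed (simp add: xmono_mult)

lemma lookup_sum_single:
  "finite S \<Longrightarrow> value_at (\<Sum>l\<in>S. Poly_Mapping.single l (f l)) n = (if n \<in> S then f n else (0::nat))"
  by (simp add: lookup_sum lookup_single when_def)

lemma transvection_on_monomial:
  assumes i: "i < k" and j: "j < k" and ij: "i \<noteq> j" and a: "a \<in> expos k d"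
  shows "lin_subst k (addrow_mat k 1 i j) (xmono a)
    = (\<Sum>s\<le>value_at a j. pconst (of_nat (value_at a j choose s)) *
        xmono (a + Poly_Mapping.single i s - Poly_Mapping.single j s))"
proof -
  let ?n = "value_at a j"
  define a' where "a' = (\<Sum>l\<in>{..<k} - {j}. Poly_Mapping.single l (value_at a l))"
  have look: "value_at a' l = (if l = j then 0 else value_at a l)" for l
    using expos_zero_outside[OF a] by (auto simp: a'_def lookup_sum_single)
  have col: "(\<Sum>r<k. pconst (addrow_mat k 1 i j $$ (r, l)) * xmono (unit_expo r))
    = (if l = j then xmono (unit_expo i) + xmono (unit_expo j) else xmono (unit_expo l))" if "l < k" for l
  proof -
    have "(\<Sum>r<k. pconst (addrow_mat k 1 i j $$ (r, l)) * xmono (unit_expo r))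
      = (\<Sum>r<k. (if r = l then xmono (unit_expo r) else 0) +
          (if r = i then (if l = j then xmono (unit_expo r) else 0) else 0))"
      using that ij by (intro sum.cong) (auto simp: pconst_def)
    then show ?thesis using that i by (simp add: sum.distrib add.commute)
  qed
  have "lin_subst k (addrow_mat k 1 i j) (xmono a)
    = (\<Prod>l<k. (if l = j then xmono (unit_expo i) + xmono (unit_expo j) else xmono (unit_expo l)) ^ value_at a l)"
    unfolding lin_subst_def lin_ext_xmono by (rule prod.cong[OF refl]) (subst col, simp_all)
  also have "\<dots> = (xmono (unit_expo i) + xmono (unit_expo j)) ^ ?n *
      (\<Prod>l\<in>{..<k} - {j}. xmono (Poly_Mapping.single l (value_at a l)))"
    using j by (subst prod.remove[of _ j]) (auto simp: xmono_unit_power intro!: prod.cong)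
  also have "(\<Prod>l\<in>{..<k} - {j}. xmono (Poly_Mapping.single l (value_at a l))) = xmono a'"
    unfolding a'_def by (rule prod_xmono) simp
  also have "(xmono (unit_expo i) + xmono (unit_expo j)) ^ ?n * xmono a'
    = (\<Sum>s\<le>?n. of_nat (?n choose s) * (xmono (Poly_Mapping.single i s) *
        xmono (Poly_Mapping.single j (?n - s)) * xmono a'))"
    by (simp add: binomial_ring xmono_unit_power sum_distrib_right mult.assoc)
  also have "\<dots> = (\<Sum>s\<le>?n. pconst (of_nat (?n choose s)) *
        xmono (a + Poly_Mapping.single i s - Poly_Mapping.single j s))"
  proof (rule sum.cong[OF refl])
    fix s assume s: "s \<in> {..?n}"
    have "Poly_Mapping.single i s + Poly_Mapping.single j (?n - s) + a'
      = a + Poly_Mapping.single i s - Poly_Mapping.single j s"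
      using ij s by (intro poly_mapping_eqI) (auto simp: lookup_add lookup_minus lookup_single when_def look)
    then show "of_nat (?n choose s) * (xmono (Poly_Mapping.single i s) *
        xmono (Poly_Mapping.single j (?n - s)) * xmono a') = pconst (of_nat (?n choose s)) *
        xmono (a + Poly_Mapping.single i s - Poly_Mapping.single j s)"
      by (simp add: xmono_mult pconst_def single_of_nat)
  qed
  finally show ?thesis .
qed

lemma lin_subst_eq_lin_ext: "lin_subst k A p = lin_ext (\<lambda>a. lin_subst k A (xmono a)) p"
  by (simp add: lin_subst_def lin_ext_xmono)

lemma single_move_in_expos:
  assumes a: "a \<in> expos k d" and i: "i < k" and j: "j < k" and s: "s \<le> value_at a j"
  shows "a + Poly_Mapping.single i s - Poly_Mapping.single j s \<in> expos k d"
proof -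
  have "(a + Poly_Mapping.single i s - Poly_Mapping.single j s) + Poly_Mapping.single j s
    = a + Poly_Mapping.single i s"
    using s by (intro poly_mapping_eqI) (auto simp: lookup_add lookup_minus lookup_single when_def)
  then show ?thesis
    using diff_in_expos[OF _ single_in_expos[OF j], of _ s "d + s"] add_in_expos[OF a single_in_expos[OF i], of s]
    by simp
qed

lemma transvection_in_hpolys:
  assumes ij: "i < k" "j < k" "i \<noteq> j" and p: "p \<in> hpolys k d"
  shows "lin_subst k (addrow_mat k 1 i j) p \<in> hpolys k d"
proof (subst lin_subst_eq_lin_ext, rule lin_ext_in_hpolys[OF p])
  fix a assume a: "a \<in> expos k d"
  have "value_at (lin_subst k (addrow_mat k 1 i j) (xmono a)) c = 0" if "c \<notin> expos k d" for c
    unfolding transvection_on_monomial[OF ij a] lookup_sum lookup_pconst_mult lookup_xmono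
    by (rule sum.neutral) (use that single_move_in_expos[OF a ij(1,2)] in auto)
  then show "lin_subst k (addrow_mat k 1 i j) (xmono a) \<in> hpolys k d"
    by (auto simp: hpolys_def in_keys_iff)
qed

text \<open>
  In general the coefficient of \<open>x\<^sup>b\<close> involves a binomial coefficient for each way of moving units
  from \<open>j\<close> to \<open>i\<close>. As \<open>x\<^sub>j\<close> does not occur in \<open>x\<^sup>b\<close>, all units have to be moved from \<open>j\<close>, which can
  be done in one way; this makes all coefficients equal to \<open>1\<close>.
\<close>
lemma transvection_on_dual_mono:
  assumes ij: "i < k" "j < k" "i \<noteq> j" and b: "b \<in> expos k d" and bj: "value_at b j = 0"
  shows "dual_act k d (addrow_mat k 1 i j) (dual_mono k d b)
    = (\<Sum>n\<le>value_at b i. dual_mono k d (b + Poly_Mapping.single j n - Poly_Mapping.single i n))"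
proof
  fix p
  let ?A = "addrow_mat k (1::bit) i j"
  let ?q = "\<lambda>n. b + Poly_Mapping.single j n - Poly_Mapping.single i n"
  show "dual_act k d ?A (dual_mono k d b) p = (\<Sum>n\<le>value_at b i. dual_mono k d (?q n)) p"
  proof (cases "p \<in> hpolys k d")
    case p: True
    have coeff: "value_at (lin_subst k ?A (xmono a)) b = (\<Sum>n\<le>value_at b i. if a = ?q n then 1 else 0)"
      if a: "a \<in> expos k d" for a
    proof -
      let ?n = "value_at a j"
      have "value_at (lin_subst k ?A (xmono a)) b = (\<Sum>s\<le>?n. of_nat (?n choose s) *
          (if a + Poly_Mapping.single i s - Poly_Mapping.single j s = b then 1 else 0))"
        by (simp add: transvection_on_monomial[OF ij a] lookup_sum lookup_pconst_mult lookup_xmono)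
      also have "\<dots> = (\<Sum>s\<in>{?n}. of_nat (?n choose s) *
          (if a + Poly_Mapping.single i s - Poly_Mapping.single j s = b then 1 else 0))"
      proof (rule sum.mono_neutral_right)
        have "a + Poly_Mapping.single i s - Poly_Mapping.single j s \<noteq> b" if "s < ?n" for s
          using that bj ij by (auto simp: lookup_add lookup_minus lookup_single when_def)
        then show "\<forall>s\<in>{..?n} - {?n}. of_nat (?n choose s) *
          (if a + Poly_Mapping.single i s - Poly_Mapping.single j s = b then 1 else 0) = (0::bit)"
          by simp
      qed simp_all
      also have "\<dots> = (if ?n \<le> value_at b i \<and> a = ?q ?n then 1 else 0)"
      proof -
        have "a + Poly_Mapping.single i ?n - Poly_Mapping.single j ?n = b
          \<longleftrightarrow> ?n \<le> value_at b i \<and> a = ?q ?n"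
          using ij bj by (auto simp: poly_mapping_eq_iff fun_eq_iff lookup_add lookup_minus lookup_single when_def split: if_splits)
        then show ?thesis by simp
      qed
      also have "\<dots> = (\<Sum>n\<le>value_at b i. if n = ?n then (if a = ?q n then 1 else 0) else 0)"
        by simp
      also have "\<dots> = (\<Sum>n\<le>value_at b i. if a = ?q n then 1 else 0)"
      proof (rule sum.cong[OF refl])
        fix n
        have "?n = n" if "a = ?q n"
          using ij bj by (simp add: that lookup_add lookup_minus lookup_single when_def)
        then show "(if n = ?n then (if a = ?q n then 1 else 0) else 0) = (if a = ?q n then 1 else (0::bit))"
          by auto
      qed
      finally show ?thesis .
    qed
    have "dual_act k d ?A (dual_mono k d b) p = value_at (lin_subst k ?A p) b"
      using p transvection_in_hpolys[OF ij p] by (simp add: dual_act_def dual_mono_def)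
    also have "\<dots> = (\<Sum>a\<in>Poly_Mapping.keys p. value_at p a * value_at (lin_subst k ?A (xmono a)) b)"
      by (subst lin_subst_eq_lin_ext) (rule lookup_lin_ext)
    also have "\<dots> = (\<Sum>a\<in>Poly_Mapping.keys p. \<Sum>n\<le>value_at b i. if a = ?q n then value_at p a else 0)"
    proof (rule sum.cong[OF refl])
      fix a assume "a \<in> Poly_Mapping.keys p"
      then have "a \<in> expos k d" using p by (auto simp: hpolys_def)
      then show "value_at p a * value_at (lin_subst k ?A (xmono a)) b
        = (\<Sum>n\<le>value_at b i. if a = ?q n then value_at p a else 0)"
        by (auto simp: coeff sum_distrib_left intro!: sum.cong)
    qed
    also have "\<dots> = (\<Sum>n\<le>value_at b i. \<Sum>a\<in>Poly_Mapping.keys p. if a = ?q n then value_at p a else 0)"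
      by (rule sum.swap)
    also have "\<dots> = (\<Sum>n\<le>value_at b i. value_at p (?q n))"
      by (rule sum.cong[OF refl]) (auto simp: sum.delta' in_keys_iff)
    finally show ?thesis using p by (simp add: sum_fun_apply dual_mono_def)
  qed (simp add: dual_act_def dual_mono_def sum_fun_apply)
qed

section \<open>The dual-spike module\<close>

text \<open>
  Outside spikes, \<open>b\<close> is obtained from \<open>e\<close> by collecting the exponents \<open>1\<close> and \<open>2\<close> at the first
  variable. Among the four duals in the transform of the dual of \<open>b\<close>, the outer two are duals
  of spikes and the inner two make up \<^const>\<open>phi\<close>.
\<close>
lemma phi_in_dual_spike_module:
  assumes e: "e \<in> zero_rows k d"
  shows "phi k d e \<in> dual_spike_module k d"
proof -
  have eb: "e \<in> row_basis k d" using e by (simp add: zero_rows_def)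
  note i = row_basisD[OF eb]
  have "phi k d e \<in> W" if W: "GL_submodule k d W" and spikes: "dual_mono k d ` spikes k d \<subseteq> W" for W
  proof -
    from e show ?thesis
    proof (cases rule: zero_row_cases)
      case spike
      then have "phi k d e = dual_mono k d e" by (simp add: phi_def evens_def[symmetric])
      then show ?thesis using spike spikes by auto
    next
      case (mixed j)
      let ?i = "first_var e"
      have j: "j \<in> evens k e" "j < k" "?i < j" using mixed(1) by (auto simp: evens_def)
      define b where "b = e + Poly_Mapping.single ?i 2 - Poly_Mapping.single j 2"
      let ?q = "\<lambda>n. b + Poly_Mapping.single j n - Poly_Mapping.single ?i n"
      have b: "b \<in> expos k d" unfolding b_def
        by (rule single_move_in_expos) (use i j mixed in auto)
      have lb: "value_at b l = (if l = ?i then 3 else if l = j then 0 else value_at e l)" for l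
        using j mixed by (auto simp: b_def lookup_add lookup_minus lookup_single when_def)
      have q3: "?q 3 \<in> expos k d"
        by (rule single_move_in_expos[OF b j(2) i(3)]) (simp add: lb)
      have lq3: "value_at (?q 3) l = (if l = ?i then 0 else if l = j then 3 else value_at e l)" for l
        using j by (auto simp: lookup_add lookup_minus lookup_single when_def lb)
      have sp: "\<exists>m. (3::nat) = 2 ^ m - 1" "\<exists>m. (0::nat) = 2 ^ m - 1"
        by (intro exI[of _ 2], simp) (intro exI[of _ 0], simp)
      have "b \<in> spikes k d" "?q 3 \<in> spikes k d"
        using b q3 sp mixed(4) by (auto simp: spikes_def lb lq3)
      then have mem: "dual_mono k d b \<in> W" "dual_mono k d (?q 3) \<in> W" using spikes by auto
      have q: "?q 0 = b" "?q 1 = shift e j" "?q 2 = e"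
        using j mixed by (auto intro!: poly_mapping_eqI simp: lookup_add lookup_minus lookup_single when_def
          lb lookup_shift[OF j(1)])
      have "dual_act k d (addrow_mat k 1 ?i j) (dual_mono k d b) = (\<Sum>n\<le>3. dual_mono k d (?q n))"
        using transvection_on_dual_mono[OF i(3) j(2) _ b] j lb by simp
      also have "\<dots> = dual_mono k d b + dual_mono k d (shift e j) + dual_mono k d e + dual_mono k d (?q 3)"
        using q by (simp add: numeral_3_eq_3 numeral_2_eq_2)
      finally have act: "dual_act k d (addrow_mat k 1 ?i j) (dual_mono k d b)
        = dual_mono k d b + dual_mono k d (shift e j) + dual_mono k d e + dual_mono k d (?q 3)" .
      have "x + y + z + w + x + w = z + y" for x y z w :: bit
        by (cases x; cases y; cases z; cases w) (simp_all add: add_bit_eq_xor)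
      then have cancel: "x + y + z + w + x + w = z + y" for x y z w :: functional
        by (simp add: fun_eq_iff)
      have "phi k d e = dual_mono k d e + dual_mono k d (shift e j)"
        using mixed(1) by (simp add: phi_def evens_def shift_def)
      also have "\<dots> = dual_act k d (addrow_mat k 1 ?i j) (dual_mono k d b) + dual_mono k d b + dual_mono k d (?q 3)"
        unfolding act by (rule cancel[symmetric])
      finally have "phi k d e = \<dots>" .
      moreover have "dual_act k d (addrow_mat k 1 ?i j) (dual_mono k d b) \<in> W"
        using W mem addrow_in_GL2[OF i(3) j(2)] j by (auto simp: GL_submodule_def)
      ultimately show ?thesis
        using W mem by (auto simp: GL_submodule_def intro!: functional.subspace_add)
    qed
  qed
  then show ?thesis using phi_in_Ker[OF e] by (auto simp: dual_spike_module_def)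
qed

lemma subspace_Ker: "functional.subspace (Ker k d)"
proof (rule functional.subspaceI)
  show "0 \<in> Ker k d" by (simp add: Ker_iff dual_space_def)
next
  fix f g assume "f \<in> Ker k d" "g \<in> Ker k d"
  then show "f + g \<in> Ker k d"
    by (simp add: Ker_iff dual_space_def distrib_left add_ac)
next
  fix c f assume "f \<in> Ker k d"
  then show "fscale c f \<in> Ker k d"
    by (simp add: Ker_iff dual_space_def fscale_def distrib_left mult.left_commute)
qed

lemma subspace_dual_spike_module: "functional.subspace (dual_spike_module k d)"
  using subspace_Ker[of k d]
  by (auto simp: functional.subspace_def dual_spike_module_def GL_submodule_def)

section \<open>Linear independence of the functionals\<close>

lemma phi_dual_basis:
  assumes e: "e \<in> row_basis k d" and e': "e' \<in> row_basis k d"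
  shows "phi k d e (xmono e') = (if e = e' then 1 else 0)"
proof -
  have "(\<Sum>j\<in>evens k e. value_at (xmono e') (shift e j)) = 0"
    by (rule sum.neutral) (use shift_notin_row_basis[OF e] e' in \<open>auto simp: lookup_xmono\<close>)
  then show ?thesis
    using phi_apply[OF xmono_in_hpolys[OF row_basisD(1)[OF e']], of e] by (auto simp: lookup_xmono)
qed

lemma inj_on_phi: "inj_on (phi k d) (row_basis k d)"
  by (rule inj_onI) (metis phi_dual_basis zero_neq_one)

lemma independent_phi: "functional.independent (phi k d ` row_basis k d)"
  unfolding functional.independent_explicit_module
proof (intro allI impI)
  fix t u w
  assume t: "finite t" "t \<subseteq> phi k d ` row_basis k d" "(\<Sum>v\<in>t. fscale (u v) v) = 0"
    and w: "w \<in> t"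
  then obtain e where e: "e \<in> row_basis k d" "phi k d e \<in> t" and we: "w = phi k d e" by blast
  have "0 = (\<Sum>v\<in>t. fscale (u v) v) (xmono e)" using t(3) by simp
  also have "\<dots> = (\<Sum>v\<in>t. if v = phi k d e then u v else 0)"
    unfolding sum_fun_apply fscale_def
  proof (rule sum.cong[OF refl])
    fix v assume "v \<in> t"
    then obtain e' where "e' \<in> row_basis k d" "v = phi k d e'" using t(2) by blast
    then show "u v * v (xmono e) = (if v = phi k d e then u v else 0)"
      using e phi_dual_basis inj_on_phi[of k d] by (auto simp: inj_on_eq_iff)
  qed
  also have "\<dots> = u (phi k d e)" using t(1) e(2) by simp
  finally show "u w = 0" by (simp add: we)
qed

theorem corollary5p4:
  fixes k d :: nat
  assumes "k \<ge> 1" and "d > 0"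
  shows "functional.span (phi k d ` zero_rows k d) \<subseteq> dual_spike_module k d \<and>
    functional.dim (functional.span (phi k d ` zero_rows k d)) = num_zero_rows k d"
proof
  show "functional.span (phi k d ` zero_rows k d) \<subseteq> dual_spike_module k d"
    by (rule functional.span_minimal) (auto simp: phi_in_dual_spike_module subspace_dual_spike_module)
  have sub: "zero_rows k d \<subseteq> row_basis k d" by (auto simp: zero_rows_def)
  then have "functional.independent (phi k d ` zero_rows k d)"
    using functional.independent_mono[OF independent_phi] by blast
  then have "functional.dim (functional.span (phi k d ` zero_rows k d)) = card (phi k d ` zero_rows k d)"
    by (rule functional.dim_span_eq_card_independent)
  also have "\<dots> = num_zero_rows k d"
    unfolding num_zero_rows_def using inj_on_subset[OF inj_on_phi sub] by (rule card_image)
  finally show "functional.dim (functional.span (phi k d ` zero_rows k d)) = num_zero_rows k d" .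
qed

end
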